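(* There is an absolute constant $K>0$ such that the following holds. Let $p\in[2,+\infty)$, $\alpha_p>0$, $q_p>2$, $\epsilon>0$, let $\mathcal{C}\subset\mathbb{R}^n$ be a nonempty compact convex set that is $(\alpha_p,q_p)$-uniformly convex with respect to the $\ell_p$-norm, let $x^*\in\mathbb{R}^n\setminus\mathcal{C}$, let $D_p=\max_{x,y\in\mathcal{C}}\|y-x\|_p$, and let $c_p=\operatorname{dist}_p(x^*,\mathcal{C})=\min_{y\in\mathcal{C}}\|y-x^*\|_p>0$. Let $f(x)=\frac12\|x-x^*\|_p^2$ for $x\in\mathbb{R}^n$, and run the Frank-Wolfe algorithm on $\min_{x\in\mathcal{C}}f(x)$, started at an arbitrary vertex of $\mathcal{C}$, with the closed-loop step-size strategy. Then the algorithm produces an iterate $x\in\mathcal{C}$ satisfying $$\|x-x^*\|_p^2-\operatorname{dist}_p(x^*,\mathcal{C})^2\leq\epsilon^2$$ whose cardinality is $\mathcal{O}(B)$, i.e. at most $K\max\{1,B\}$, where $$B=\frac{(pD_p^2)^{(q_p-2)/q_p}(1+\beta_1)+(p/\beta_2)/(\alpha_pc_p)^{2/q_p}}{\epsilon^{2(q_p-2)/q_p}},$$ $$\beta_1=\frac{2-2^{(q_p-2)/q_p}}{2^{(q_p-2)/q_p}-1},\qquad\beta_2=\frac{q_p-2}{q_p}-\frac{2}{q_p}\left(2^{(q_p-2)/q_p}-1\right).$$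
   Context: $\|\cdot\|_p$ is the $\ell_p$-norm on $\mathbb{R}^n$ and $\langle\cdot,\cdot\rangle$ the Euclidean inner product. Vertices of $\mathcal{C}$ are its extreme points. A set $\mathcal{C}$ is $(\alpha,q)$-uniformly convex with respect to a norm $\|\cdot\|$ if $\alpha,q>0$ and for all $x,y\in\mathcal{C}$, $\gamma\in[0,1]$, and $z\in\mathbb{R}^n$ with $\|z\|=1$, we have $(1-\gamma)x+\gamma y+(1-\gamma)\gamma\alpha\|x-y\|^qz\in\mathcal{C}$. Frank-Wolfe algorithm (FW) for a differentiable function $f$ over $\mathcal{C}$: start at a vertex $x_0$ of $\mathcal{C}$; for $t=0,1,2,\ldots$ let $v_t$ be a vertex of $\mathcal{C}$ belonging to $\arg\min_{v\in\mathcal{C}}\langle v,\nabla f(x_t)\rangle$, and set $x_{t+1}=x_t+\gamma_t(v_t-x_t)$ with $\gamma_t\in[0,1]$. Here, for $x\neq x^*$, the $i$-th entry of $\nabla f(x)$ is $\|x-x^*\|_p^{2-p}\operatorname{sign}([x-x^*]_i)|[x-x^*]_i|^{p-1}$. Closed-loop strategy: $\gamma_t=\min\left\{\frac{\langle x_t-v_t,\nabla f(x_t)\rangle}{(p-1)\|x_t-v_t\|_p^2},1\right\}$ (if $v_t=x_t$, the value of $\gamma_t$ is irrelevant). Each iterate $x_{t+1}=(1-\gamma_t)x_t+\gamma_tv_t$ comes with an explicit convex decomposition over $x_0,v_0,\ldots,v_t$. The cardinality of an iterate is the number of distinct vertices with positive weight in this decomposition. *)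

theory Defs
  imports "HOL-Analysis.Analysis" "HOL-Library.Function_Algebras"
begin

text \<open>
  The constant in the main statement does not depend on the dimension, so the dimension has to be
  quantified inside the formula and cannot be a type. As in the library's
  \<^const>\<open>Euclidean_space\<close>, a vector of \<open>\<real>\<^sup>n\<close> is a function \<^typ>\<open>nat \<Rightarrow> real\<close> that vanishes
  from index \<open>n\<close> on. The pointwise vector space structure makes \<^const>\<open>convex\<close> and
  \<^const>\<open>extreme_point_of\<close> available.
\<close>

instantiation "fun" :: (type, real_vector) real_vector
begin

definition "r *\<^sub>R f = (\<lambda>x. r *\<^sub>R f x)"

instance
  by standard (simp_all add: scaleR_fun_def fun_eq_iff scaleR_add_left scaleR_add_right)

end

lemma scaleR_fun_apply [simp]: "(r *\<^sub>R f) x = r *\<^sub>R f x"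
  by (simp add: scaleR_fun_def)

abbreviation rn :: "nat \<Rightarrow> (nat \<Rightarrow> real) set" where
  "rn n \<equiv> topspace (Euclidean_space n)"

definition inner_n :: "nat \<Rightarrow> (nat \<Rightarrow> real) \<Rightarrow> (nat \<Rightarrow> real) \<Rightarrow> real" where
  "inner_n n x y = (\<Sum>i<n. x i * y i)"

definition lp_norm :: "nat \<Rightarrow> real \<Rightarrow> (nat \<Rightarrow> real) \<Rightarrow> real" where
  "lp_norm n p x = (\<Sum>i<n. \<bar>x i\<bar> powr p) powr (1 / p)"

text \<open>For nonempty compact sets the supremum and the infimum below are attained.\<close>

definition lp_diam :: "nat \<Rightarrow> real \<Rightarrow> (nat \<Rightarrow> real) set \<Rightarrow> real" where
  "lp_diam n p C = Sup {lp_norm n p (y - x) | x y. x \<in> C \<and> y \<in> C}"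

definition lp_dist :: "nat \<Rightarrow> real \<Rightarrow> (nat \<Rightarrow> real) \<Rightarrow> (nat \<Rightarrow> real) set \<Rightarrow> real" where
  "lp_dist n p u C = Inf {lp_norm n p (y - u) | y. y \<in> C}"

definition uniformly_convex_set ::
  "nat \<Rightarrow> ((nat \<Rightarrow> real) \<Rightarrow> real) \<Rightarrow> real \<Rightarrow> real \<Rightarrow> (nat \<Rightarrow> real) set \<Rightarrow> bool" where
  "uniformly_convex_set n N \<alpha> q C \<longleftrightarrow> \<alpha> > 0 \<and> q > 0 \<and>
     (\<forall>x\<in>C. \<forall>y\<in>C. \<forall>\<gamma>\<in>{0..1}. \<forall>z\<in>rn n. N z = 1 \<longrightarrow>
        (1 - \<gamma>) *\<^sub>R x + \<gamma> *\<^sub>R y + ((1 - \<gamma>) * \<gamma> * \<alpha> * N (x - y) powr q) *\<^sub>R z \<in> C)"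

text \<open>The gradient of a differentiable function is the vector of its partial derivatives.\<close>

definition gradient :: "nat \<Rightarrow> ((nat \<Rightarrow> real) \<Rightarrow> real) \<Rightarrow> (nat \<Rightarrow> real) \<Rightarrow> nat \<Rightarrow> real" where
  "gradient n f x = (\<lambda>i. if i < n then deriv (\<lambda>s. f (x(i := s))) (x i) else 0)"

text \<open>
  The sequences \<open>x\<close>, \<open>v\<close>, \<open>\<gamma>\<close> form a run of the Frank-Wolfe algorithm. The starting vertex and,
  among several minimizing vertices, the choice of \<open>v t\<close> are free.
\<close>

definition frank_wolfe_run ::
  "nat \<Rightarrow> ((nat \<Rightarrow> real) \<Rightarrow> real) \<Rightarrow> (nat \<Rightarrow> real) set \<Rightarrow>
   (nat \<Rightarrow> nat \<Rightarrow> real) \<Rightarrow> (nat \<Rightarrow> nat \<Rightarrow> real) \<Rightarrow> (nat \<Rightarrow> real) \<Rightarrow> bool" where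
  "frank_wolfe_run n f C x v \<gamma> \<longleftrightarrow>
     x 0 extreme_point_of C \<and>
     (\<forall>t. v t extreme_point_of C \<and>
          is_arg_min (\<lambda>w. inner_n n w (gradient n f (x t))) (\<lambda>w. w \<in> C) (v t) \<and>
          \<gamma> t \<in> {0..1} \<and>
          x (Suc t) = x t + \<gamma> t *\<^sub>R (v t - x t))"

text \<open>If \<open>v t = x t\<close>, the step size is unconstrained (apart from lying in \<open>[0, 1]\<close>).\<close>

definition closed_loop_steps ::
  "nat \<Rightarrow> real \<Rightarrow> ((nat \<Rightarrow> real) \<Rightarrow> real) \<Rightarrow>
   (nat \<Rightarrow> nat \<Rightarrow> real) \<Rightarrow> (nat \<Rightarrow> nat \<Rightarrow> real) \<Rightarrow> (nat \<Rightarrow> real) \<Rightarrow> bool" where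
  "closed_loop_steps n p f x v \<gamma> \<longleftrightarrow>
     (\<forall>t. v t \<noteq> x t \<longrightarrow>
        \<gamma> t = min (inner_n n (x t - v t) (gradient n f (x t)) /
                   ((p - 1) * (lp_norm n p (x t - v t))\<^sup>2)) 1)"

text \<open>
  \<open>fw_weight x0 v \<gamma> t u\<close> is the total weight of the vertex \<open>u\<close> in the convex decomposition of the
  \<open>t\<close>-th iterate over \<open>x0, v 0, \<dots>, v (t - 1)\<close> that results from unfolding
  \<open>x (Suc t) = (1 - \<gamma> t) *\<^sub>R x t + \<gamma> t *\<^sub>R v t\<close>; the weights of repeated vertices are added up.
\<close>

primrec fw_weight ::
  "(nat \<Rightarrow> real) \<Rightarrow> (nat \<Rightarrow> nat \<Rightarrow> real) \<Rightarrow> (nat \<Rightarrow> real) \<Rightarrow> nat \<Rightarrow> (nat \<Rightarrow> real) \<Rightarrow> real" where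
  "fw_weight x0 v \<gamma> 0 = (\<lambda>u. if u = x0 then 1 else 0)"
| "fw_weight x0 v \<gamma> (Suc t) =
     (\<lambda>u. (1 - \<gamma> t) * fw_weight x0 v \<gamma> t u + (if u = v t then \<gamma> t else 0))"

definition fw_cardinality ::
  "(nat \<Rightarrow> real) \<Rightarrow> (nat \<Rightarrow> nat \<Rightarrow> real) \<Rightarrow> (nat \<Rightarrow> real) \<Rightarrow> nat \<Rightarrow> nat" where
  "fw_cardinality x0 v \<gamma> t = card {u. fw_weight x0 v \<gamma> t u > 0}"

definition beta1 :: "real \<Rightarrow> real" where
  "beta1 q = (2 - 2 powr ((q - 2) / q)) / (2 powr ((q - 2) / q) - 1)"

definition beta2 :: "real \<Rightarrow> real" where
  "beta2 q = (q - 2) / q - 2 / q * (2 powr ((q - 2) / q) - 1)"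

definition bound_B :: "real \<Rightarrow> real \<Rightarrow> real \<Rightarrow> real \<Rightarrow> real \<Rightarrow> real \<Rightarrow> real" where
  "bound_B p \<alpha> q D c \<epsilon> =
     ((p * D\<^sup>2) powr ((q - 2) / q) * (1 + beta1 q) + (p / beta2 q) / (\<alpha> * c) powr (2 / q)) /
     \<epsilon> powr (2 * (q - 2) / q)"

lemma fw_weight_support:
  "{u. fw_weight x0 v \<gamma> t u \<noteq> 0} \<subseteq> insert x0 (v ` {..<t})"
  by (induction t) (auto split: if_splits)

lemma finite_fw_weight: "finite {u. fw_weight x0 v \<gamma> t u > 0}"
  by (rule finite_subset[of _ "insert x0 (v ` {..<t})"])
     (use fw_weight_support[of x0 v \<gamma> t] in force, simp)

lemma fw_weight_decomposition:
  assumes "\<And>t. x (Suc t) = x t + \<gamma> t *\<^sub>R (v t - x t)"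
    and "finite A" "insert (x 0) (v ` {..<t}) \<subseteq> A"
  shows "(\<Sum>u\<in>A. fw_weight (x 0) v \<gamma> t u) = 1"
    and "(\<Sum>u\<in>A. fw_weight (x 0) v \<gamma> t u * u i) = x t i"
proof -
  have "(\<Sum>u\<in>A. fw_weight (x 0) v \<gamma> t u) = 1 \<and> (\<Sum>u\<in>A. fw_weight (x 0) v \<gamma> t u * u i) = x t i"
    using assms(3)
  proof (induction t)
    case 0
    then show ?case using assms(2) by (simp add: if_distrib[of "\<lambda>c. c * _"] cong: if_cong)
  next
    case (Suc t)
    then have IH: "(\<Sum>u\<in>A. fw_weight (x 0) v \<gamma> t u) = 1"
      "(\<Sum>u\<in>A. fw_weight (x 0) v \<gamma> t u * u i) = x t i" and v: "v t \<in> A"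
      by (auto simp: lessThan_Suc)
    have "(\<Sum>u\<in>A. fw_weight (x 0) v \<gamma> (Suc t) u) = 1"
      using v assms(2) IH by (simp add: sum.distrib sum_distrib_left[symmetric])
    moreover have "(\<Sum>u\<in>A. fw_weight (x 0) v \<gamma> (Suc t) u * u i) =
        (1 - \<gamma> t) * (\<Sum>u\<in>A. fw_weight (x 0) v \<gamma> t u * u i) + \<gamma> t * v t i"
      using v assms(2)
      by (simp add: sum.distrib sum_distrib_left distrib_right mult.assoc
          if_distrib[of "\<lambda>c. c * _"] cong: if_cong)
    moreover have "x (Suc t) i = (1 - \<gamma> t) * x t i + \<gamma> t * v t i"
      unfolding assms(1)[of t] by (simp add: algebra_simps)
    ultimately show ?case using IH by metis
  qed
  then show "(\<Sum>u\<in>A. fw_weight (x 0) v \<gamma> t u) = 1"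
    and "(\<Sum>u\<in>A. fw_weight (x 0) v \<gamma> t u * u i) = x t i" by auto
qed

lemma has_real_derivative_abs_powr:
  fixes s p :: real
  assumes "p > 1"
  shows "((\<lambda>s. \<bar>s\<bar> powr p) has_real_derivative p * sgn s * \<bar>s\<bar> powr (p - 1)) (at s)"
proof (cases "s = 0")
  case True
  have "((\<lambda>h::real. \<bar>h\<bar> powr (p - 1)) \<longlongrightarrow> 0) (at 0)"
    using assms by (auto intro!: tendsto_eq_intros)
  moreover have "\<bar>\<bar>h\<bar> powr p / h\<bar> = \<bar>h\<bar> powr (p - 1)" if "h \<noteq> 0" for h :: real
    using that by (simp add: powr_diff abs_divide)
  ultimately have "((\<lambda>h::real. \<bar>\<bar>h\<bar> powr p / h\<bar>) \<longlongrightarrow> 0) (at 0)"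
    by (subst filterlim_cong[OF refl refl, where g = "\<lambda>h. \<bar>h\<bar> powr (p - 1)"])
       (auto simp: eventually_at_filter)
  then show ?thesis
    using True assms unfolding tendsto_rabs_zero_iff by (simp add: DERIV_def)
next
  case False
  have "(abs has_real_derivative sgn s) (at s)"
  proof (cases "s > 0")
    case True
    then have "(abs has_real_derivative 1) (at s)"
      by (intro has_field_derivative_transform_within_open[OF DERIV_ident, where S = "{0<..}"]) auto
    then show ?thesis using True by simp
  next
    case False
    with \<open>s \<noteq> 0\<close> have "s < 0" by simp
    then have "(abs has_real_derivative - 1) (at s)"
      by (intro has_field_derivative_transform_within_open[OF DERIV_minus[OF DERIV_ident], where S = "{..<0}"])
        auto
    then show ?thesis using \<open>s < 0\<close> by simp
  qed
  from DERIV_chain2[OF has_real_derivative_powr this, of p] False show ?thesis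
    by (simp add: mult_ac)
qed

text \<open>The explicit form of the gradient of half the squared distance to a point.\<close>

lemma gradient_half_sq_lp:
  assumes "p \<ge> 2" "i < n" "lp_norm n p (x - u) \<noteq> 0"
  shows "((\<lambda>s. 1 / 2 * (lp_norm n p (x(i := s) - u))\<^sup>2) has_real_derivative
           lp_norm n p (x - u) powr (2 - p) * sgn (x i - u i) * \<bar>x i - u i\<bar> powr (p - 1)) (at (x i))"
    and "gradient n (\<lambda>y. 1 / 2 * (lp_norm n p (y - u))\<^sup>2) x i =
           lp_norm n p (x - u) powr (2 - p) * sgn (x i - u i) * \<bar>x i - u i\<bar> powr (p - 1)"
proof -
  define R where "R = (\<Sum>j\<in>{..<n} - {i}. \<bar>x j - u j\<bar> powr p)"
  define S where "S = R + \<bar>x i - u i\<bar> powr p"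
  have split: "(\<Sum>j<n. \<bar>(x(i := s) - u) j\<bar> powr p) = R + \<bar>s - u i\<bar> powr p" for s
    using assms(2) by (subst sum.remove[of _ i]) (auto simp: R_def intro!: sum.cong)
  have R0: "R \<ge> 0" unfolding R_def by (intro sum_nonneg) auto
  have N: "lp_norm n p (x - u) = S powr (1 / p)"
    using split[of "x i"] by (simp add: lp_norm_def S_def)
  have S: "S > 0"
    using N assms(3) R0 by (cases "S = 0") (auto simp: S_def less_le)
  have eq: "(\<lambda>s. 1 / 2 * (lp_norm n p (x(i := s) - u))\<^sup>2) =
      (\<lambda>s. 1 / 2 * (R + \<bar>s - u i\<bar> powr p) powr (2 / p))"
    by (rule ext) (simp only: lp_norm_def split, simp add: power2_eq_square powr_add[symmetric])
  have 1: "((\<lambda>s. R + \<bar>s - u i\<bar> powr p) has_real_derivative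
      p * sgn (x i - u i) * \<bar>x i - u i\<bar> powr (p - 1)) (at (x i))"
  proof -
    have "((\<lambda>s. s - u i) has_real_derivative 1) (at (x i))"
      by (auto intro!: derivative_eq_intros)
    from DERIV_chain2[OF has_real_derivative_abs_powr this, of p] assms(1)
    have "((\<lambda>s. \<bar>s - u i\<bar> powr p) has_real_derivative
        p * sgn (x i - u i) * \<bar>x i - u i\<bar> powr (p - 1)) (at (x i))"
      by simp
    from DERIV_add[OF DERIV_const[of R] this] show ?thesis by simp
  qed
  have "((\<lambda>s. (R + \<bar>s - u i\<bar> powr p) powr (2 / p)) has_real_derivative
      2 / p * S powr (2 / p - 1) * (p * sgn (x i - u i) * \<bar>x i - u i\<bar> powr (p - 1))) (at (x i))"
    using DERIV_chain2[OF has_real_derivative_powr 1, of "2 / p"] S by (simp add: S_def)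
  then have "((\<lambda>s. 1 / 2 * (R + \<bar>s - u i\<bar> powr p) powr (2 / p)) has_real_derivative
      1 / 2 * (2 / p * S powr (2 / p - 1) * (p * sgn (x i - u i) * \<bar>x i - u i\<bar> powr (p - 1)))) (at (x i))"
    by (rule DERIV_cmult)
  also have "1 / 2 * (2 / p * S powr (2 / p - 1) * (p * sgn (x i - u i) * \<bar>x i - u i\<bar> powr (p - 1))) =
      S powr (2 / p - 1) * sgn (x i - u i) * \<bar>x i - u i\<bar> powr (p - 1)"
    using assms(1) by simp
  also have "S powr (2 / p - 1) = lp_norm n p (x - u) powr (2 - p)"
    using assms(1) by (simp add: N powr_powr diff_divide_distrib)
  finally show D: "((\<lambda>s. 1 / 2 * (lp_norm n p (x(i := s) - u))\<^sup>2) has_real_derivative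
      lp_norm n p (x - u) powr (2 - p) * sgn (x i - u i) * \<bar>x i - u i\<bar> powr (p - 1)) (at (x i))"
    by (simp only: eq)
  show "gradient n (\<lambda>y. 1 / 2 * (lp_norm n p (y - u))\<^sup>2) x i =
      lp_norm n p (x - u) powr (2 - p) * sgn (x i - u i) * \<bar>x i - u i\<bar> powr (p - 1)"
    using DERIV_imp_deriv[OF D] assms(2) by (simp add: gradient_def)
qed

end

theory Submission
  imports Defs
begin

text \<open>
  Let \<open>f\<close> be half the squared \<open>p\<close>-norm distance to \<open>u\<close>, let \<open>h\<close> be the primal gap of \<open>f\<close> at an
  iterate, \<open>g\<close> the Frank-Wolfe gap and \<open>d\<close> the \<open>p\<close>-norm of the step from the iterate to its
  Frank-Wolfe vertex. Three inequalities drive the algorithm. Convexity of \<open>f\<close> gives \<open>h \<le> g\<close>. As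
  \<open>p \<ge> 2\<close>, the function \<open>f\<close> is \<open>(p - 1)\<close>-smooth for the \<open>p\<close>-norm (\<open>half_sq_lp_smooth\<close>), so the
  closed-loop step, which minimizes the quadratic upper model over \<open>[0, 1]\<close>, lowers \<open>h\<close> by at least
  \<open>(g / 2) min (g / ((p - 1) d\<^sup>2)) 1\<close>. Finally the dual norm of the gradient equals the distance to
  \<open>u\<close>, hence is at least \<open>c\<close>, and uniform convexity of the set turns this into
  \<open>g \<ge> \<alpha> c d powr q\<close> (\<open>uniformly_convex_gap\<close>), so that steps are short when the gap is small.

  Eliminating \<open>g\<close> and \<open>d\<close> leaves a recursion for \<open>h\<close> alone: with \<open>r = (q - 2) / q\<close> and
  \<open>M = (\<alpha> c) powr (2 / q) / (p - 1)\<close>, the next gap is at most \<open>h - (h / 2) min (M h powr r) 1\<close>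
  (\<open>closed_loop_step_progress\<close>). While the gap is large it is halved, so \<open>- log 2 h\<close> grows by one;
  once it is small, \<open>h powr (- r)\<close> grows by \<open>r M / 2\<close>. A suitable combination of the two
  quantities therefore grows by at least one in every step (\<open>progress_potential_step\<close>), which bounds
  the number of steps before \<open>h \<le> \<epsilon>\<^sup>2 / 2\<close> by a logarithmic and a polynomial term. The first step
  already brings \<open>h\<close> below \<open>p D\<^sup>2 / 2\<close>; estimating the logarithm by the power \<open>r\<close> of its argument
  divided by \<open>r\<close> gives the first summand of the bound, since \<open>1 + \<beta>\<^sub>1 \<ge> 1 / r\<close>, and the polynomial
  term gives the second, since \<open>0 < \<beta>\<^sub>2 \<le> r\<close>. Each step adds at most one vertex to the
  decomposition, so the cardinality is at most the number of steps plus one.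
\<close>

section \<open>Hoelder's inequality and the duality map\<close>

text \<open>
  After both sums are normalized to one, the terms are estimated by Young's inequality. The weights
  \<open>\<theta>\<close> and \<open>1 - \<theta>\<close> occur as exponents of the terms, so that the pairings with the first and with the
  second derivative of the \<open>p\<close>-th power of the norm are instances for \<open>\<theta> = (p - 1) / p\<close> and
  \<open>\<theta> = (p - 2) / p\<close>.
\<close>

lemma Holder_sum_powr:
  fixes a b :: "'i \<Rightarrow> real" and \<theta> :: real
  assumes "0 < \<theta>" "\<theta> < 1" and fin: "finite I"
    and a: "\<And>i. i \<in> I \<Longrightarrow> a i \<ge> 0" and b: "\<And>i. i \<in> I \<Longrightarrow> b i \<ge> 0"
  shows "(\<Sum>i\<in>I. a i powr \<theta> * b i powr (1 - \<theta>)) \<le> (sum a I) powr \<theta> * (sum b I) powr (1 - \<theta>)"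
proof (cases "sum a I = 0 \<or> sum b I = 0")
  case True
  then have "(\<forall>i\<in>I. a i = 0) \<or> (\<forall>i\<in>I. b i = 0)"
    using fin a b by (metis sum_nonneg_eq_0_iff)
  then have "(\<Sum>i\<in>I. a i powr \<theta> * b i powr (1 - \<theta>)) = 0"
    by (auto intro!: sum.neutral)
  then show ?thesis by simp
next
  case False
  define A B where "A = sum a I" and "B = sum b I"
  have AB: "A > 0" "B > 0"
    using False sum_nonneg[of I a] sum_nonneg[of I b] a b by (auto simp: A_def B_def less_le)
  have "(\<Sum>i\<in>I. a i powr \<theta> * b i powr (1 - \<theta>))
      \<le> (\<Sum>i\<in>I. A powr \<theta> * B powr (1 - \<theta>) * (\<theta> * (a i / A) + (1 - \<theta>) * (b i / B)))"
  proof (rule sum_mono)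
    fix i assume i: "i \<in> I"
    have "(a i / A) powr \<theta> * (b i / B) powr (1 - \<theta>) \<le> \<theta> * (a i / A) + (1 - \<theta>) * (b i / B)"
    proof (cases "a i = 0 \<or> b i = 0")
      case True
      then show ?thesis using assms(1,2) a[OF i] b[OF i] AB by auto
    next
      case False
      then show ?thesis
        using assms(1,2) a[OF i] b[OF i] AB by (intro Youngs_inequality_0) (auto simp: less_le)
    qed
    then have "A powr \<theta> * B powr (1 - \<theta>) * ((a i / A) powr \<theta> * (b i / B) powr (1 - \<theta>))
        \<le> A powr \<theta> * B powr (1 - \<theta>) * (\<theta> * (a i / A) + (1 - \<theta>) * (b i / B))"
      by (intro mult_left_mono) auto
    moreover have "A powr \<theta> * B powr (1 - \<theta>) * ((a i / A) powr \<theta> * (b i / B) powr (1 - \<theta>))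
        = a i powr \<theta> * b i powr (1 - \<theta>)"
      using AB a[OF i] b[OF i] by (simp add: powr_divide)
    ultimately show "a i powr \<theta> * b i powr (1 - \<theta>)
        \<le> A powr \<theta> * B powr (1 - \<theta>) * (\<theta> * (a i / A) + (1 - \<theta>) * (b i / B))" by simp
  qed
  also have "\<dots> = A powr \<theta> * B powr (1 - \<theta>) * (\<theta> * (sum a I / A) + (1 - \<theta>) * (sum b I / B))"
    by (simp add: sum_distrib_left[symmetric] sum.distrib sum_divide_distrib[symmetric])
  also have "\<dots> = A powr \<theta> * B powr (1 - \<theta>)"
    using AB by (simp add: A_def[symmetric] B_def[symmetric])
  finally show ?thesis by (simp add: A_def B_def)
qed

lemma lp_norm_nonneg: "lp_norm n p w \<ge> 0"
  by (simp add: lp_norm_def)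

lemma lp_norm_powr_p:
  assumes "p > 0"
  shows "lp_norm n p w powr p = (\<Sum>i<n. \<bar>w i\<bar> powr p)"
  using assms by (simp add: lp_norm_def powr_powr sum_nonneg)

lemma lp_norm_scale:
  assumes "p > 0" and "\<And>i. i < n \<Longrightarrow> u i = s * w i"
  shows "lp_norm n p u = \<bar>s\<bar> * lp_norm n p w"
proof -
  have "(\<Sum>i<n. \<bar>u i\<bar> powr p) = \<bar>s\<bar> powr p * (\<Sum>i<n. \<bar>w i\<bar> powr p)"
    using assms(2) by (simp add: abs_mult powr_mult sum_distrib_left)
  then show ?thesis
    using assms(1) by (simp add: lp_norm_def powr_mult sum_nonneg powr_powr)
qed

lemma lp_norm_eq_0:
  assumes "p > 0"
  shows "lp_norm n p w = 0 \<longleftrightarrow> (\<forall>i<n. w i = 0)"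
proof -
  have "lp_norm n p w = 0 \<longleftrightarrow> (\<Sum>i<n. \<bar>w i\<bar> powr p) = 0"
    by (simp add: lp_norm_def)
  also have "\<dots> \<longleftrightarrow> (\<forall>i<n. w i = 0)"
    by (subst sum_nonneg_eq_0_iff) auto
  finally show ?thesis .
qed

lemma lp_norm_diff_pos:
  assumes "p > 0" "x \<in> rn n" "y \<in> rn n" "x \<noteq> y"
  shows "lp_norm n p (x - y) > 0"
proof -
  have "lp_norm n p (x - y) \<noteq> 0"
  proof
    assume "lp_norm n p (x - y) = 0"
    then have "\<forall>i<n. x i = y i" using assms(1) by (simp add: lp_norm_eq_0)
    moreover have "\<forall>i\<ge>n. x i = y i" using assms(2,3) by (simp add: topspace_Euclidean_space)
    ultimately have "x = y" by (metis ext not_le)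
    then show False using assms(4) by simp
  qed
  then show ?thesis using lp_norm_nonneg[of n p "x - y"] by linarith
qed

text \<open>
  The normalized duality map of the \<open>p\<close>-norm, which is the gradient of half the squared norm.
\<close>

definition lp_dual :: "nat \<Rightarrow> real \<Rightarrow> (nat \<Rightarrow> real) \<Rightarrow> nat \<Rightarrow> real" where
  "lp_dual n p w i = (if i < n then lp_norm n p w powr (2 - p) * sgn (w i) * \<bar>w i\<bar> powr (p - 1) else 0)"

lemma inner_lp_dual:
  "inner_n n y (lp_dual n p w) =
     lp_norm n p w powr (2 - p) * (\<Sum>i<n. sgn (w i) * \<bar>w i\<bar> powr (p - 1) * y i)"
  by (simp add: inner_n_def lp_dual_def sum_distrib_left mult_ac)

lemma inner_lp_dual_self:
  assumes "p > 1" "lp_norm n p w \<noteq> 0"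
  shows "inner_n n w (lp_dual n p w) = (lp_norm n p w)\<^sup>2"
proof -
  have *: "sgn (w i) * \<bar>w i\<bar> powr (p - 1) * w i = \<bar>w i\<bar> powr p" for i
    using assms(1) by (cases "w i > 0"; cases "w i = 0") (auto simp: powr_diff)
  have "inner_n n w (lp_dual n p w) = lp_norm n p w powr (2 - p) * lp_norm n p w powr p"
    using assms(1) by (simp add: inner_lp_dual * lp_norm_powr_p)
  also have "\<dots> = lp_norm n p w powr 2"
    by (simp add: powr_add[symmetric])
  finally show ?thesis
    using assms(2) lp_norm_nonneg[of n p w] by simp
qed

text \<open>
  Together with the preceding identity this says that the dual norm of the image of \<open>w\<close> is exactly
  the \<open>p\<close>-norm of \<open>w\<close>.
\<close>

lemma inner_lp_dual_le:
  assumes p: "p > 1"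
  shows "inner_n n y (lp_dual n p w) \<le> lp_norm n p w * lp_norm n p y"
proof (cases "lp_norm n p w = 0")
  case True
  then show ?thesis by (simp add: inner_lp_dual)
next
  case False
  define N where "N = lp_norm n p w"
  have N: "N > 0" using False lp_norm_nonneg[of n p w] by (simp add: N_def)
  have e: "p * ((p - 1) / p) = p - 1" "p * (1 - (p - 1) / p) = 1"
    using p by (simp_all add: field_simps)
  have "(\<Sum>i<n. sgn (w i) * \<bar>w i\<bar> powr (p - 1) * y i)
      \<le> (\<Sum>i<n. (\<bar>w i\<bar> powr p) powr ((p - 1) / p) * (\<bar>y i\<bar> powr p) powr (1 - (p - 1) / p))"
  proof (rule sum_mono)
    fix i
    have "sgn (w i) * \<bar>w i\<bar> powr (p - 1) * y i \<le> \<bar>sgn (w i) * \<bar>w i\<bar> powr (p - 1) * y i\<bar>" by simp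
    also have "\<dots> \<le> \<bar>w i\<bar> powr (p - 1) * \<bar>y i\<bar>" by (auto simp: abs_mult sgn_if)
    also have "\<dots> = (\<bar>w i\<bar> powr p) powr ((p - 1) / p) * (\<bar>y i\<bar> powr p) powr (1 - (p - 1) / p)"
      by (simp only: powr_powr e) simp
    finally show "sgn (w i) * \<bar>w i\<bar> powr (p - 1) * y i
      \<le> (\<bar>w i\<bar> powr p) powr ((p - 1) / p) * (\<bar>y i\<bar> powr p) powr (1 - (p - 1) / p)" .
  qed
  also have "\<dots> \<le> (\<Sum>i<n. \<bar>w i\<bar> powr p) powr ((p - 1) / p) * (\<Sum>i<n. \<bar>y i\<bar> powr p) powr (1 - (p - 1) / p)"
    using p by (intro Holder_sum_powr) auto
  also have "\<dots> = N powr (p - 1) * lp_norm n p y"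
  proof -
    have "p > 0" using p by simp
    from lp_norm_powr_p[OF this, of n, symmetric] show ?thesis
      by (simp only: powr_powr e N_def) (simp add: lp_norm_nonneg)
  qed
  finally have "inner_n n y (lp_dual n p w) \<le> N powr (2 - p) * (N powr (p - 1) * lp_norm n p y)"
    by (simp add: inner_lp_dual N_def mult_left_mono)
  also have "\<dots> = N powr ((2 - p) + (p - 1)) * lp_norm n p y"
    by (simp only: powr_add mult.assoc)
  finally show ?thesis using N by (simp add: N_def)
qed

lemma inner_n_diff_left: "inner_n n (x - y) g = inner_n n x g - inner_n n y g"
  by (simp add: inner_n_def left_diff_distrib sum_subtractf)

text \<open>
  Convexity of half the squared norm comes directly from the two properties of the duality map:
  \<open>\<parallel>w\<parallel> \<parallel>y\<parallel>\<close> is at most the mean of the squares.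
\<close>

lemma half_sq_lp_subgradient:
  assumes "p > 1" "lp_norm n p w \<noteq> 0"
  shows "(lp_norm n p w)\<^sup>2 / 2 - (lp_norm n p y)\<^sup>2 / 2 \<le> inner_n n (w - y) (lp_dual n p w)"
proof -
  have "2 * (lp_norm n p w * lp_norm n p y) \<le> (lp_norm n p w)\<^sup>2 + (lp_norm n p y)\<^sup>2"
    using sum_squares_bound[of "lp_norm n p w" "lp_norm n p y"] by simp
  then show ?thesis
    using inner_lp_dual_self[OF assms] inner_lp_dual_le[OF assms(1), of n y w]
    unfolding inner_n_diff_left by linarith
qed

section \<open>Smoothness of half the squared norm\<close>

text \<open>
  The exponent two is singled out because \<open>0 powr 0 = 0\<close>, whereas the derivative of the identity at
  zero is one.
\<close>

lemma has_real_derivative_sgn_abs_powr: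
  fixes s p :: real
  assumes "p \<ge> 2"
  shows "((\<lambda>s. sgn s * \<bar>s\<bar> powr (p - 1)) has_real_derivative
           (p - 1) * (if p = 2 then 1 else \<bar>s\<bar> powr (p - 2))) (at s)"
proof (cases "p = 2")
  case True
  have "(\<lambda>s::real. sgn s * \<bar>s\<bar> powr (p - 1)) = (\<lambda>s. s)"
    using True by (auto simp: sgn_if)
  then show ?thesis using True by simp
next
  case False
  then have p: "p > 2" using assms by simp
  show ?thesis
  proof (cases "s = 0")
    case True
    have "((\<lambda>h::real. \<bar>h\<bar> powr (p - 2)) \<longlongrightarrow> 0) (at 0)"
      using p by (auto intro!: tendsto_eq_intros)
    moreover have "sgn h * \<bar>h\<bar> powr (p - 1) / h = \<bar>h\<bar> powr (p - 2)" if "h \<noteq> 0" for h :: real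
    proof -
      have "\<bar>h\<bar> powr (p - 1) = \<bar>h\<bar> powr (p - 2) * \<bar>h\<bar>"
        using that powr_add[of "\<bar>h\<bar>" "p - 2" 1] by simp
      then show ?thesis using that by (simp add: sgn_if)
    qed
    ultimately have "((\<lambda>h::real. sgn h * \<bar>h\<bar> powr (p - 1) / h) \<longlongrightarrow> 0) (at 0)"
      by (subst filterlim_cong[OF refl refl, where g = "\<lambda>h. \<bar>h\<bar> powr (p - 2)"])
         (auto simp: eventually_at_filter)
    then show ?thesis using True p by (simp add: DERIV_def)
  next
    case False
    have "((\<lambda>s. sgn s * \<bar>s\<bar> powr (p - 1)) has_real_derivative
           sgn s * ((p - 1) * sgn s * \<bar>s\<bar> powr (p - 1 - 1))) (at s)"
    proof (rule has_field_derivative_transform_within)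
      show "((\<lambda>u. sgn s * \<bar>u\<bar> powr (p - 1)) has_real_derivative
           sgn s * ((p - 1) * sgn s * \<bar>s\<bar> powr (p - 1 - 1))) (at s)"
        using p by (intro DERIV_cmult has_real_derivative_abs_powr) simp
      show "0 < \<bar>s\<bar>" using False by simp
      show "sgn s * \<bar>u\<bar> powr (p - 1) = sgn u * \<bar>u\<bar> powr (p - 1)" if "dist u s < \<bar>s\<bar>" for u
        using that by (auto simp: dist_real_def sgn_if split: if_splits)
    qed simp
    moreover have "(p - 1) * (if p = 2 then 1 else \<bar>s\<bar> powr (p - 2))
        = sgn s * ((p - 1) * sgn s * \<bar>s\<bar> powr (p - 1 - 1))"
      using False p by (simp add: sgn_if)
    ultimately show ?thesis by (simp only:)
  qed
qed

lemma sum_abs_powr_mult_square_le: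
  assumes p: "p > 2"
  shows "(\<Sum>i<n. \<bar>u i\<bar> powr (p - 2) * (d i)\<^sup>2)
          \<le> (\<Sum>i<n. \<bar>u i\<bar> powr p) powr ((p - 2) / p) * (lp_norm n p d)\<^sup>2"
proof -
  have e: "p * ((p - 2) / p) = p - 2" "p * (1 - (p - 2) / p) = 2"
    using p by (simp_all add: field_simps)
  have "(\<Sum>i<n. \<bar>u i\<bar> powr (p - 2) * (d i)\<^sup>2)
      = (\<Sum>i<n. (\<bar>u i\<bar> powr p) powr ((p - 2) / p) * (\<bar>d i\<bar> powr p) powr (1 - (p - 2) / p))"
    by (rule sum.cong) (simp_all only: powr_powr e, simp)
  also have "\<dots> \<le> (\<Sum>i<n. \<bar>u i\<bar> powr p) powr ((p - 2) / p) * (\<Sum>i<n. \<bar>d i\<bar> powr p) powr (1 - (p - 2) / p)"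
    using p by (intro Holder_sum_powr) auto
  also have "(\<Sum>i<n. \<bar>d i\<bar> powr p) powr (1 - (p - 2) / p) = (lp_norm n p d)\<^sup>2"
  proof -
    have "p > 0" using p by simp
    from lp_norm_powr_p[OF this, of n d, symmetric] show ?thesis
      by (simp only: powr_powr e) (simp add: lp_norm_nonneg)
  qed
  finally show ?thesis .
qed

lemma quadratic_upper_bound_from_second_derivative:
  fixes \<phi> \<phi>' \<phi>'' :: "real \<Rightarrow> real"
  assumes 1: "\<And>s. s \<in> {0..1} \<Longrightarrow> (\<phi> has_real_derivative \<phi>' s) (at s)"
    and 2: "\<And>s. s \<in> {0..1} \<Longrightarrow> (\<phi>' has_real_derivative \<phi>'' s) (at s)"
    and le: "\<And>s. s \<in> {0..1} \<Longrightarrow> \<phi>'' s \<le> M"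
  shows "\<phi> 1 \<le> \<phi> 0 + \<phi>' 0 + M / 2"
proof -
  have *: "\<phi>' s \<le> \<phi>' 0 + M * s" if "s \<in> {0..1}" for s
  proof -
    have "\<phi>' 0 - M * 0 \<ge> \<phi>' s - M * s"
    proof (rule DERIV_nonpos_imp_nonincreasing[where f = "\<lambda>s. \<phi>' s - M * s"])
      fix u assume "0 \<le> u" "u \<le> s"
      with that have u: "u \<in> {0..1}" by simp
      have "((\<lambda>s. \<phi>' s - M * s) has_real_derivative \<phi>'' u - M) (at u)"
        using 2[OF u] by (auto intro!: derivative_eq_intros)
      then show "\<exists>y. ((\<lambda>s. \<phi>' s - M * s) has_real_derivative y) (at u) \<and> y \<le> 0"
        using le[OF u] by (intro exI[of _ "\<phi>'' u - M"]) simp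
    qed (use that in simp)
    then show ?thesis by simp
  qed
  have "\<phi> 0 - \<phi>' 0 * 0 - M / 2 * 0\<^sup>2 \<ge> \<phi> 1 - \<phi>' 0 * 1 - M / 2 * 1\<^sup>2"
  proof (rule DERIV_nonpos_imp_nonincreasing[where f = "\<lambda>s. \<phi> s - \<phi>' 0 * s - M / 2 * s\<^sup>2"])
    fix u :: real assume "0 \<le> u" "u \<le> 1"
    then have u: "u \<in> {0..1}" by simp
    have "((\<lambda>s. \<phi> s - \<phi>' 0 * s - M / 2 * s\<^sup>2) has_real_derivative \<phi>' u - \<phi>' 0 - M * u) (at u)"
      using 1[OF u] by (auto intro!: derivative_eq_intros)
    then show "\<exists>y. ((\<lambda>s. \<phi> s - \<phi>' 0 * s - M / 2 * s\<^sup>2) has_real_derivative y) (at u) \<and> y \<le> 0"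
      using *[OF u] by (intro exI[of _ "\<phi>' u - \<phi>' 0 - M * u"]) simp
  qed simp
  then show ?thesis by simp
qed

text \<open>
  Along the segment, write \<open>F\<close> for the \<open>p\<close>-th power of the norm, so that half the squared norm is
  \<open>F powr (2 / p) / 2\<close>. In its second derivative the term with the square of the first derivative of
  \<open>F\<close> carries the factor \<open>2 / p - 1 \<le> 0\<close> and can be dropped; the other term is at most
  \<open>(p - 1) \<parallel>d\<parallel>\<^sup>2\<close> by Hoelder's inequality. The segment must avoid the origin, where \<open>F\<close> vanishes and
  the chain rule for the power of \<open>F\<close> breaks down.
\<close>

lemma half_sq_lp_smooth:
  assumes p: "p \<ge> 2"
    and nz: "\<And>s. s \<in> {0..1} \<Longrightarrow> lp_norm n p (\<lambda>i. w i + s * d i) \<noteq> 0"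
  shows "(lp_norm n p (w + d))\<^sup>2 / 2
          \<le> (lp_norm n p w)\<^sup>2 / 2 + inner_n n d (lp_dual n p w) + (p - 1) / 2 * (lp_norm n p d)\<^sup>2"
proof -
  define F where "F s = (\<Sum>i<n. \<bar>w i + s * d i\<bar> powr p)" for s
  define G where "G s = (\<Sum>i<n. sgn (w i + s * d i) * \<bar>w i + s * d i\<bar> powr (p - 1) * d i)" for s
  define H where "H s = (\<Sum>i<n. (if p = 2 then 1 else \<bar>w i + s * d i\<bar> powr (p - 2)) * (d i)\<^sup>2)" for s
  have F: "F s > 0" if "s \<in> {0..1}" for s
    using nz[OF that] sum_nonneg[of "{..<n}" "\<lambda>i. \<bar>w i + s * d i\<bar> powr p"]
    by (auto simp: lp_norm_def F_def less_le)
  have lin: "((\<lambda>s. w i + s * d i) has_real_derivative d i) (at s)" for i s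
    by (auto intro!: derivative_eq_intros)
  have dF: "(F has_real_derivative p * G s) (at s)" for s
  proof -
    have "(F has_real_derivative
        (\<Sum>i<n. p * sgn (w i + s * d i) * \<bar>w i + s * d i\<bar> powr (p - 1) * d i)) (at s)"
      unfolding F_def using p
      by (intro DERIV_sum DERIV_chain2[OF has_real_derivative_abs_powr lin]) simp
    then show ?thesis by (simp add: G_def sum_distrib_left mult.assoc)
  qed
  have dG: "(G has_real_derivative (p - 1) * H s) (at s)" for s
  proof -
    have "(G has_real_derivative
        (\<Sum>i<n. (p - 1) * (if p = 2 then 1 else \<bar>w i + s * d i\<bar> powr (p - 2)) * d i * d i)) (at s)"
      unfolding G_def using p
      by (intro DERIV_sum DERIV_cmult_right DERIV_chain2[OF has_real_derivative_sgn_abs_powr lin]) simp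
    then show ?thesis by (simp only: H_def sum_distrib_left mult.assoc power2_eq_square)
  qed
  \<comment> \<open>Half the squared norm along the segment and its first two derivatives.\<close>
  define \<phi> where "\<phi> s = 1 / 2 * F s powr (2 / p)" for s
  define \<phi>' where "\<phi>' s = F s powr (2 / p - 1) * G s" for s
  define \<phi>'' where "\<phi>'' s = (2 / p - 1) * F s powr (2 / p - 1 - 1) * (p * G s) * G s
      + (p - 1) * H s * F s powr (2 / p - 1)" for s
  have "\<phi> 1 \<le> \<phi> 0 + \<phi>' 0 + (p - 1) * (lp_norm n p d)\<^sup>2 / 2"
  proof (rule quadratic_upper_bound_from_second_derivative[where \<phi> = \<phi> and \<phi>' = \<phi>' and \<phi>'' = \<phi>''])
    fix s :: real assume s: "s \<in> {0..1}"
    have dpowr: "((\<lambda>s. F s powr r) has_real_derivative r * F s powr (r - 1) * (p * G s)) (at s)" for r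
      using DERIV_chain2[OF has_real_derivative_powr dF, OF F[OF s]] .
    from DERIV_cmult[OF dpowr[of "2 / p"], of "1 / 2"]
    have d\<phi>s: "(\<phi> has_real_derivative 1 / 2 * (2 / p * F s powr (2 / p - 1) * (p * G s))) (at s)"
      unfolding \<phi>_def[abs_def] .
    have "1 / 2 * (2 / p * a * (p * b)) = a * b" for a b
      using p by simp
    then have "1 / 2 * (2 / p * F s powr (2 / p - 1) * (p * G s)) = \<phi>' s"
      unfolding \<phi>'_def .
    with d\<phi>s show "(\<phi> has_real_derivative \<phi>' s) (at s)" by (simp only:)
    from DERIV_mult[OF dpowr[of "2 / p - 1"] dG[of s]] show "(\<phi>' has_real_derivative \<phi>'' s) (at s)"
      unfolding \<phi>'_def[abs_def] \<phi>''_def .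
    have "(2 / p - 1) * a * (p * b) * b = (2 - p) * (a * b\<^sup>2)" for a b
      using p by (simp add: power2_eq_square field_simps)
    then have "(2 / p - 1) * F s powr (2 / p - 1 - 1) * (p * G s) * G s
        = (2 - p) * (F s powr (2 / p - 1 - 1) * (G s)\<^sup>2)" .
    also have "\<dots> \<le> 0" using p by (intro mult_nonpos_nonneg) auto
    finally have neg: "(2 / p - 1) * F s powr (2 / p - 1 - 1) * (p * G s) * G s \<le> 0" .
    have "H s * F s powr (2 / p - 1) \<le> (lp_norm n p d)\<^sup>2"
    proof (cases "p = 2")
      case True
      have "(lp_norm n p d)\<^sup>2 = lp_norm n p d powr p"
        using True lp_norm_nonneg[of n p d] by simp
      then have "(lp_norm n p d)\<^sup>2 = H s"
        using True by (simp add: lp_norm_powr_p H_def)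
      then show ?thesis using True F[OF s] by simp
    next
      case False
      then have p2: "p > 2" using p by simp
      have "H s \<le> F s powr ((p - 2) / p) * (lp_norm n p d)\<^sup>2"
        using sum_abs_powr_mult_square_le[OF p2, of "\<lambda>i. w i + s * d i" d n] False
        by (simp add: H_def F_def)
      then have "H s * F s powr (2 / p - 1)
          \<le> F s powr ((p - 2) / p) * (lp_norm n p d)\<^sup>2 * F s powr (2 / p - 1)"
        by (intro mult_right_mono) auto
      also have "\<dots> = F s powr ((p - 2) / p + (2 / p - 1)) * (lp_norm n p d)\<^sup>2"
        by (simp add: powr_add)
      also have "(p - 2) / p + (2 / p - 1) = 0" using p by (simp add: field_simps)
      finally show ?thesis using F[OF s] by simp
    qed
    then have "(p - 1) * (H s * F s powr (2 / p - 1)) \<le> (p - 1) * (lp_norm n p d)\<^sup>2"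
      using p by (intro mult_left_mono) auto
    then show "\<phi>'' s \<le> (p - 1) * (lp_norm n p d)\<^sup>2"
      using neg by (simp add: \<phi>''_def mult.assoc)
  qed
  moreover have "\<phi> 1 = (lp_norm n p (w + d))\<^sup>2 / 2" "\<phi> 0 = (lp_norm n p w)\<^sup>2 / 2"
    by (simp_all add: \<phi>_def F_def lp_norm_def power2_eq_square powr_add[symmetric])
  moreover have "\<phi>' 0 = inner_n n d (lp_dual n p w)"
    using p by (simp add: \<phi>'_def inner_lp_dual F_def G_def lp_norm_def powr_powr diff_divide_distrib)
  ultimately show ?thesis by simp
qed

section \<open>Distance and diameter of a compact set\<close>

lemma continuous_on_lp_norm:
  assumes "p > 0" "\<And>i. i < n \<Longrightarrow> continuous_on S (\<lambda>a. g a i)"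
  shows "continuous_on S (\<lambda>a. lp_norm n p (g a))"
  unfolding lp_norm_def using assms
  by (intro continuous_on_powr' continuous_on_sum continuous_on_rabs continuous_on_const) (auto intro: sum_nonneg)

lemma compactin_Euclidean_space_imp_compact:
  assumes "compactin (Euclidean_space n) C"
  shows "compact C"
  using assms by (simp add: Euclidean_space_def compactin_subtopology euclidean_product_topology)

lemma continuous_on_apply: "continuous_on S (\<lambda>x::nat \<Rightarrow> real. x i)"
  by (rule continuous_on_subset[OF continuous_on_product_coordinates]) simp

lemma lp_dist_le:
  assumes "y \<in> C"
  shows "lp_dist n p u C \<le> lp_norm n p (y - u)"
  unfolding lp_dist_def using assms
  by (intro cInf_lower bdd_belowI[of _ 0]) (auto intro: lp_norm_nonneg)

text \<open>
  The distance is attained by compactness. Positivity is what keeps the gradient bounded away from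
  zero on the set.
\<close>

lemma lp_dist_pos:
  assumes "p > 0" "compactin (Euclidean_space n) C" "C \<noteq> {}" "u \<in> rn n - C"
  shows "lp_dist n p u C > 0"
proof -
  have "continuous_on C (\<lambda>y. lp_norm n p (y - u))"
  proof (rule continuous_on_lp_norm[OF assms(1)])
    fix i
    have "continuous_on C (\<lambda>y. y i - u i)"
      by (rule continuous_on_diff[OF continuous_on_apply continuous_on_const])
    then show "continuous_on C (\<lambda>y. (y - u) i)" by simp
  qed
  from continuous_attains_inf[OF compactin_Euclidean_space_imp_compact[OF assms(2)] assms(3) this]
  obtain z where z: "z \<in> C" "\<And>y. y \<in> C \<Longrightarrow> lp_norm n p (z - u) \<le> lp_norm n p (y - u)" by auto
  have "C \<subseteq> rn n" using assms(2) by (rule compactin_subset_topspace)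
  then have "0 < lp_norm n p (z - u)"
    using assms(1,4) z(1) by (intro lp_norm_diff_pos) auto
  also have "lp_norm n p (z - u) \<le> lp_dist n p u C"
    unfolding lp_dist_def using assms(3) z(2) by (intro cInf_greatest) auto
  finally show ?thesis .
qed

lemma lp_norm_le_lp_diam:
  assumes "p > 0" "compactin (Euclidean_space n) C" "x \<in> C" "y \<in> C"
  shows "lp_norm n p (y - x) \<le> lp_diam n p C"
proof -
  have "continuous_on (C \<times> C) (\<lambda>z. lp_norm n p (snd z - fst z))"
  proof (rule continuous_on_lp_norm[OF assms(1)])
    fix i
    have "continuous_on (C \<times> C) (\<lambda>z. snd z i - fst z i)"
      by (rule continuous_on_diff[OF continuous_on_compose2[OF continuous_on_apply[of UNIV] continuous_on_snd[OF continuous_on_id]]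
            continuous_on_compose2[OF continuous_on_apply[of UNIV] continuous_on_fst[OF continuous_on_id]]]) simp_all
    then show "continuous_on (C \<times> C) (\<lambda>z. (snd z - fst z) i)" by simp
  qed
  then have "compact ((\<lambda>z. lp_norm n p (snd z - fst z)) ` (C \<times> C))"
    using compactin_Euclidean_space_imp_compact[OF assms(2)]
    by (intro compact_continuous_image compact_Times)
  then have "bdd_above ((\<lambda>z. lp_norm n p (snd z - fst z)) ` (C \<times> C))"
    by (intro bounded_imp_bdd_above compact_imp_bounded)
  moreover have "{lp_norm n p (y - x) | x y. x \<in> C \<and> y \<in> C} = (\<lambda>z. lp_norm n p (snd z - fst z)) ` (C \<times> C)"
    by (auto simp: image_def Bex_def) 
  ultimately show ?thesis
    unfolding lp_diam_def using assms(3,4) by (intro cSup_upper) auto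
qed

section \<open>Progress of one step\<close>

lemma inner_n_lincomb:
  "inner_n n (a *\<^sub>R x + b *\<^sub>R y + c *\<^sub>R z) g = a * inner_n n x g + b * inner_n n y g + c * inner_n n z g"
  by (simp add: inner_n_def sum.distrib sum_distrib_left distrib_right mult.assoc)

text \<open>
  Uniform convexity is applied with the unit vector opposite to \<open>x - u\<close>, along which the linear
  functional decreases at the rate of its dual norm \<open>\<parallel>x - u\<parallel>\<close>. The point obtained from the parameter
  \<open>s\<close> cannot beat the minimizer \<open>v\<close>; after division by \<open>1 - s\<close> the claim follows by letting \<open>s\<close> tend to
  one.
\<close>

lemma uniformly_convex_gap:
  assumes p: "p > 1" and uc: "uniformly_convex_set n (lp_norm n p) \<alpha> q C"
    and C: "C \<subseteq> rn n" and x: "x \<in> C" and v: "v \<in> C" and u: "u \<in> rn n"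
    and nz: "lp_norm n p (x - u) \<noteq> 0"
    and min: "\<And>y. y \<in> C \<Longrightarrow> inner_n n v (lp_dual n p (x - u)) \<le> inner_n n y (lp_dual n p (x - u))"
  shows "\<alpha> * lp_norm n p (x - v) powr q * lp_norm n p (x - u) \<le> inner_n n (x - v) (lp_dual n p (x - u))"
proof (rule field_le_mult_one_interval)
  fix s :: real assume s: "0 < s" "s < 1"
  define N where "N = lp_norm n p (x - u)"
  define J where "J = lp_dual n p (x - u)"
  define z where "z = (- 1 / N) *\<^sub>R (x - u)"
  define \<delta> where "\<delta> = (1 - s) * s * \<alpha> * lp_norm n p (x - v) powr q"
  have N: "N > 0" using nz lp_norm_nonneg[of n p "x - u"] by (simp add: N_def)
  have "x \<in> rn n" using x C by blast
  then have "z \<in> rn n" using u by (simp add: z_def topspace_Euclidean_space)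
  moreover have "lp_norm n p z = 1"
  proof -
    have "lp_norm n p z = \<bar>- 1 / N\<bar> * lp_norm n p (x - u)"
      using p by (intro lp_norm_scale) (auto simp: z_def)
    then show ?thesis using N by (simp add: N_def)
  qed
  ultimately have "(1 - s) *\<^sub>R x + s *\<^sub>R v + \<delta> *\<^sub>R z \<in> C"
    using uc x v s unfolding uniformly_convex_set_def \<delta>_def by simp
  from min[OF this] have "inner_n n v J \<le> (1 - s) * inner_n n x J + s * inner_n n v J + \<delta> * inner_n n z J"
    by (simp add: J_def inner_n_lincomb)
  moreover have "inner_n n z J = - N"
  proof -
    have "inner_n n z J = (- 1 / N) * inner_n n (x - u) J"
      by (simp add: z_def inner_n_def sum_divide_distrib sum_negf)
    also have "\<dots> = (- 1 / N) * N\<^sup>2"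
      using inner_lp_dual_self[OF p nz] by (simp add: J_def N_def)
    finally show ?thesis using N by (simp add: power2_eq_square)
  qed
  ultimately have "\<delta> * N \<le> (1 - s) * (inner_n n x J - inner_n n v J)"
    by (simp add: algebra_simps)
  then have "(1 - s) * (s * (\<alpha> * lp_norm n p (x - v) powr q * N)) \<le> (1 - s) * inner_n n (x - v) J"
    by (simp add: \<delta>_def inner_n_diff_left mult_ac)
  then show "s * (\<alpha> * lp_norm n p (x - v) powr q * lp_norm n p (x - u))
      \<le> inner_n n (x - v) (lp_dual n p (x - u))"
    using s by (simp add: N_def J_def)
qed

text \<open>
  The step size minimizes the quadratic model \<open>- \<gamma> g + L / 2 (\<gamma> d)\<^sup>2\<close> over \<open>[0, 1]\<close>. The second bound
  compares it with the full step.
\<close>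

lemma short_step_bounds:
  fixes g L d \<gamma> :: real
  assumes "g \<ge> 0" "L > 0" "d > 0" and \<gamma>: "\<gamma> = min (g / (L * d\<^sup>2)) 1"
  shows "- \<gamma> * g + L / 2 * (\<gamma> * d)\<^sup>2 \<le> - (g / 2) * min (g / (L * d\<^sup>2)) 1"
    and "- \<gamma> * g + L / 2 * (\<gamma> * d)\<^sup>2 \<le> L / 2 * d\<^sup>2 - g"
proof -
  define A where "A = L * d\<^sup>2"
  have A: "A > 0" using assms by (simp add: A_def)
  have eq: "- \<gamma> * g + L / 2 * (\<gamma> * d)\<^sup>2 = - \<gamma> * g + A / 2 * \<gamma>\<^sup>2" "L / 2 * d\<^sup>2 = A / 2"
    by (simp_all add: A_def power_mult_distrib)
  have "- \<gamma> * g + A / 2 * \<gamma>\<^sup>2 \<le> - (g / 2) * \<gamma> \<and> - \<gamma> * g + A / 2 * \<gamma>\<^sup>2 \<le> A / 2 - g"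
  proof (cases "g \<le> A")
    case True
    then have \<gamma>': "\<gamma> = g / A" using A \<gamma> by (simp add: A_def[symmetric] min_def)
    have "A / 2 - g - (- \<gamma> * g + A / 2 * \<gamma>\<^sup>2) = (A - g)\<^sup>2 / (2 * A)"
      using A by (simp add: \<gamma>' field_simps power2_eq_square)
    moreover have "(A - g)\<^sup>2 / (2 * A) \<ge> 0" using A by simp
    moreover have "- \<gamma> * g + A / 2 * \<gamma>\<^sup>2 = - (g / 2) * \<gamma>"
      using A by (simp add: \<gamma>' field_simps power2_eq_square)
    ultimately show ?thesis by linarith
  next
    case False
    then have "\<gamma> = 1" using A \<gamma> by (simp add: A_def[symmetric] min_def field_simps)
    then show ?thesis using False by simp
  qed
  then show "- \<gamma> * g + L / 2 * (\<gamma> * d)\<^sup>2 \<le> - (g / 2) * min (g / (L * d\<^sup>2)) 1"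
    and "- \<gamma> * g + L / 2 * (\<gamma> * d)\<^sup>2 \<le> L / 2 * d\<^sup>2 - g"
    using \<gamma> unfolding eq by auto
qed

text \<open>
  The gap condition bounds \<open>d\<^sup>2\<close> by a multiple of \<open>g powr (2 / q)\<close>; the remaining power
  \<open>(q - 2) / q\<close> of \<open>g\<close> is then replaced by that of \<open>h\<close>.
\<close>

lemma gap_step_size_lower_bound:
  fixes a d g h L q :: real
  assumes "q > 2" "a > 0" "d > 0" "L > 0" "0 < h" "h \<le> g" and gap: "a * d powr q \<le> g"
  shows "a powr (2 / q) / L * h powr ((q - 2) / q) \<le> g / (L * d\<^sup>2)"
proof -
  have "a powr (2 / q) * d\<^sup>2 = (a * d powr q) powr (2 / q)"
    using assms by (simp add: powr_mult powr_powr)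
  also have "\<dots> \<le> g powr (2 / q)"
    using assms by (intro powr_mono2) auto
  finally have 1: "a powr (2 / q) * d\<^sup>2 \<le> g powr (2 / q)" .
  have 2: "h powr ((q - 2) / q) \<le> g powr ((q - 2) / q)"
    using assms by (intro powr_mono2) auto
  have "(a powr (2 / q) * d\<^sup>2) * h powr ((q - 2) / q) \<le> g powr (2 / q) * g powr ((q - 2) / q)"
    using 1 2 by (intro mult_mono) auto
  also have "\<dots> = g powr (2 / q + (q - 2) / q)" by (simp add: powr_add)
  also have "2 / q + (q - 2) / q = 1" using assms(1) by (simp add: field_simps)
  finally have "a powr (2 / q) * h powr ((q - 2) / q) * d\<^sup>2 \<le> g"
    using assms by (simp add: mult_ac)
  then show ?thesis using assms by (simp add: field_simps)
qed

lemma gradient_half_sq_lp_eq_dual: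
  assumes "p \<ge> 2" "lp_norm n p (x - u) \<noteq> 0"
  shows "gradient n (\<lambda>y. 1 / 2 * (lp_norm n p (y - u))\<^sup>2) x = lp_dual n p (x - u)"
proof
  fix i
  show "gradient n (\<lambda>y. 1 / 2 * (lp_norm n p (y - u))\<^sup>2) x i = lp_dual n p (x - u) i"
  proof (cases "i < n")
    case True
    then show ?thesis using gradient_half_sq_lp(2)[OF assms(1) True assms(2)] by (simp add: lp_dual_def)
  qed (simp add: gradient_def lp_dual_def)
qed

text \<open>
  The second bound does not involve the current gap: it compares with a full step and uses \<open>h \<le> g\<close>.
  Applied to the first step, it makes the number of iterations independent of the starting vertex.
  A positive gap forces \<open>g > 0\<close> and therefore \<open>v \<noteq> x\<close>, the case in which the step size is prescribed.
\<close>

lemma closed_loop_step_progress: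
  assumes p: "p \<ge> 2" and q: "q > 2" and cpt: "compactin (Euclidean_space n) C" and "convex C"
    and uc: "uniformly_convex_set n (lp_norm n p) \<alpha> q C"
    and u: "u \<in> rn n - C" and c: "c = lp_dist n p u C"
    and x: "x \<in> C" and v: "v \<in> C" and \<gamma>: "\<gamma> \<in> {0..1}"
    and J: "J = lp_dual n p (x - u)"
    and min: "\<And>y. y \<in> C \<Longrightarrow> inner_n n v J \<le> inner_n n y J"
    and step: "v \<noteq> x \<Longrightarrow> \<gamma> = min (inner_n n (x - v) J / ((p - 1) * (lp_norm n p (x - v))\<^sup>2)) 1"
    and h: "h = (\<lambda>y. (lp_norm n p (y - u))\<^sup>2 / 2 - c\<^sup>2 / 2)" and pos: "h x > 0"
    and x': "x' = x + \<gamma> *\<^sub>R (v - x)"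
  shows "h x' \<le> h x - h x / 2 * min ((\<alpha> * c) powr (2 / q) / (p - 1) * h x powr ((q - 2) / q)) 1"
    and "h x' \<le> (p - 1) / 2 * (lp_diam n p C)\<^sup>2"
proof -
  have p0: "p > 0" "p > 1" using p by auto
  have C: "C \<subseteq> rn n" using cpt by (rule compactin_subset_topspace)
  have ne: "C \<noteq> {}" using x by auto
  have c0: "c > 0" unfolding c using p0(1) cpt ne u by (rule lp_dist_pos)
  have cle: "c \<le> lp_norm n p (y - u)" if "y \<in> C" for y
    using lp_dist_le[OF that] by (simp add: c)
  have nz: "lp_norm n p (y - u) \<noteq> 0" if "y \<in> C" for y
    using cle[OF that] c0 by linarith
  define g where "g = inner_n n (x - v) J"
  define d where "d = lp_norm n p (x - v)"
  have hg: "h x \<le> g"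
  proof (rule ccontr)
    assume "\<not> h x \<le> g"
    \<comment> \<open>Otherwise all points of the set are at distance at least some \<open>e > c\<close> from \<open>u\<close>.\<close>
    then have lt: "c\<^sup>2 < (lp_norm n p (x - u))\<^sup>2 - 2 * g" by (simp add: h)
    define e where "e = sqrt ((lp_norm n p (x - u))\<^sup>2 - 2 * g)"
    have "e \<le> lp_norm n p (y - u)" if y: "y \<in> C" for y
    proof -
      have "(lp_norm n p (x - u))\<^sup>2 / 2 - (lp_norm n p (y - u))\<^sup>2 / 2 \<le> inner_n n ((x - u) - (y - u)) J"
        unfolding J by (rule half_sq_lp_subgradient[OF p0(2) nz[OF x]])
      also have "\<dots> \<le> g"
        using min[OF y] by (simp add: g_def inner_n_diff_left)
      finally have "(lp_norm n p (x - u))\<^sup>2 - 2 * g \<le> (lp_norm n p (y - u))\<^sup>2" by simp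
      then show ?thesis unfolding e_def using lp_norm_nonneg by (intro real_le_lsqrt) auto
    qed
    then have "e \<le> c" unfolding c lp_dist_def using ne by (intro cInf_greatest) auto
    moreover have "c < e" unfolding e_def using lt by (rule real_less_rsqrt)
    ultimately show False by simp
  qed
  have g0: "g > 0" using hg pos by simp
  have vx: "v \<noteq> x" using g0 by (auto simp: g_def inner_n_diff_left)
  have d0: "d > 0" unfolding d_def using p0(1) C x v vx by (intro lp_norm_diff_pos) auto
  have \<gamma>eq: "\<gamma> = min (g / ((p - 1) * d\<^sup>2)) 1" using step[OF vx] by (simp add: g_def d_def)
  have gap: "\<alpha> * c * d powr q \<le> g"
  proof -
    have "\<alpha> > 0" using uc by (simp add: uniformly_convex_set_def)
    then have "\<alpha> * d powr q * c \<le> \<alpha> * d powr q * lp_norm n p (x - u)"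
      using cle[OF x] by (intro mult_left_mono) auto
    also have "\<dots> \<le> g"
      unfolding g_def d_def J using p0(2) uc C x v u nz[OF x] min
      by (intro uniformly_convex_gap) (auto simp: J)
    finally show ?thesis by (simp add: mult_ac)
  qed
  have smooth: "h x' \<le> h x + (- \<gamma> * g + (p - 1) / 2 * (\<gamma> * d)\<^sup>2)"
  proof -
    have seg: "lp_norm n p (\<lambda>i. (x - u) i + s * (\<gamma> *\<^sub>R (v - x)) i) \<noteq> 0" if s: "s \<in> {0..1}" for s
    proof -
      have "s * \<gamma> \<in> {0..1}" using s \<gamma> by (auto simp: mult_le_one)
      then have "(1 - s * \<gamma>) *\<^sub>R x + (s * \<gamma>) *\<^sub>R v \<in> C"
        using \<open>convex C\<close> x v by (intro convexD_alt) auto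
      from nz[OF this] show ?thesis
        by (simp add: fun_eq_iff algebra_simps lp_norm_def)
    qed
    have "x' - u = (x - u) + \<gamma> *\<^sub>R (v - x)" by (simp add: x')
    moreover have "inner_n n (\<gamma> *\<^sub>R (v - x)) J = - \<gamma> * g"
      by (simp add: g_def inner_n_def sum_distrib_left sum_negf[symmetric] algebra_simps)
    moreover have "lp_norm n p (\<gamma> *\<^sub>R (v - x)) = \<gamma> * d"
    proof -
      have "lp_norm n p (\<gamma> *\<^sub>R (v - x)) = \<bar>- \<gamma>\<bar> * d"
        unfolding d_def using p0(1) by (intro lp_norm_scale) (auto simp: algebra_simps)
      then show ?thesis using \<gamma> by simp
    qed
    ultimately have "(lp_norm n p (x' - u))\<^sup>2 / 2
        \<le> (lp_norm n p (x - u))\<^sup>2 / 2 + - \<gamma> * g + (p - 1) / 2 * (\<gamma> * d)\<^sup>2"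
      using half_sq_lp_smooth[OF p seg, folded J] by metis
    then show ?thesis by (simp add: h)
  qed
  have p1: "p - 1 > 0" using p by simp
  note bounds = short_step_bounds[OF less_imp_le[OF g0] p1 d0 \<gamma>eq]
  have "min ((\<alpha> * c) powr (2 / q) / (p - 1) * h x powr ((q - 2) / q)) 1 \<le> min (g / ((p - 1) * d\<^sup>2)) 1"
    using gap_step_size_lower_bound[OF q _ d0 _ pos hg gap, of "p - 1"] uc c0 p
    by (intro min.mono) (auto simp: uniformly_convex_set_def)
  then have "h x / 2 * min ((\<alpha> * c) powr (2 / q) / (p - 1) * h x powr ((q - 2) / q)) 1
      \<le> g / 2 * min (g / ((p - 1) * d\<^sup>2)) 1"
    using pos hg g0 p by (intro mult_mono) auto
  then show "h x' \<le> h x - h x / 2 * min ((\<alpha> * c) powr (2 / q) / (p - 1) * h x powr ((q - 2) / q)) 1"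
    using smooth bounds(1) by simp
  have "d \<le> lp_diam n p C"
    unfolding d_def using p0(1) cpt v x by (rule lp_norm_le_lp_diam)
  then have "(p - 1) / 2 * d\<^sup>2 \<le> (p - 1) / 2 * (lp_diam n p C)\<^sup>2"
    using d0 p by (intro mult_left_mono power_mono) auto
  then show "h x' \<le> (p - 1) / 2 * (lp_diam n p C)\<^sup>2"
    using smooth bounds(2) hg by linarith
qed

section \<open>Counting the iterations\<close>

lemma one_plus_le_powr_neg:
  fixes r y :: real
  assumes "r > 0" "0 \<le> y" "y < 1"
  shows "1 + r * y \<le> (1 - y) powr (- r)"
proof -
  have "ln (1 - y) \<le> - y" using ln_le_minus_one[of "1 - y"] assms by simp
  then have "r * y \<le> r * - ln (1 - y)" using assms by (intro mult_left_mono) auto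
  then have "r * y \<le> - r * ln (1 - y)" by simp
  moreover have "1 + - r * ln (1 - y) \<le> exp (- r * ln (1 - y))"
    by (rule exp_ge_add_one_self)
  ultimately show ?thesis using assms by (simp add: powr_def)
qed

text \<open>
  The logarithm records the steps that halve the gap. The coefficient of the power is the
  reciprocal of the growth \<open>r M / 2\<close> of \<open>y powr (- r)\<close> in the remaining steps.
\<close>

definition progress_potential :: "real \<Rightarrow> real \<Rightarrow> real \<Rightarrow> real" where
  "progress_potential r M y = 2 / (r * M) * y powr (- r) - log 2 y"

lemma progress_potential_antimono:
  assumes "r > 0" "M > 0" "0 < y" "y \<le> z"
  shows "progress_potential r M z \<le> progress_potential r M y"
proof -
  have "z powr (- r) \<le> y powr (- r)" using assms by (simp add: powr_mono2')
  then have "2 / (r * M) * z powr (- r) \<le> 2 / (r * M) * y powr (- r)"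
    using assms by (intro mult_left_mono) auto
  moreover have "log 2 y \<le> log 2 z" using assms by simp
  ultimately show ?thesis by (simp add: progress_potential_def)
qed

text \<open>
  Both summands increase as the gap decreases, so it is enough that one of them gains one: the power
  by Bernoulli's inequality if \<open>M h powr r \<le> 1\<close>, the logarithm otherwise.
\<close>

lemma progress_potential_step:
  fixes h h' r M :: real
  assumes "r > 0" "M > 0" "h' > 0" "h > 0" and le: "h' \<le> h - h / 2 * min (M * h powr r) 1"
  shows "progress_potential r M h + 1 \<le> progress_potential r M h'"
proof (cases "M * h powr r \<le> 1")
  case True
  define y where "y = M * h powr r / 2"
  have y: "0 \<le> y" "y < 1" using True assms by (auto simp: y_def)
  have "h' \<le> h * (1 - y)" using le True by (simp add: y_def min_def algebra_simps)
  have "2 / (r * M) * (h * (1 - y)) powr (- r) = 2 / (r * M) * h powr (- r) * (1 - y) powr (- r)"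
    using y assms by (simp add: powr_mult)
  also have "\<dots> \<ge> 2 / (r * M) * h powr (- r) * (1 + r * y)"
    using y assms by (intro mult_left_mono one_plus_le_powr_neg) auto
  also have "2 / (r * M) * h powr (- r) * (1 + r * y)
      = 2 / (r * M) * h powr (- r) + h powr (- r) * h powr r"
    using assms by (simp add: y_def field_simps)
  also have "h powr (- r) * h powr r = 1"
    using assms by (simp add: powr_add[symmetric])
  finally have "2 / (r * M) * h powr (- r) + 1 \<le> 2 / (r * M) * (h * (1 - y)) powr (- r)" .
  moreover have "log 2 (h * (1 - y)) \<le> log 2 h"
    using y assms by (simp add: mult_le_cancel_left1)
  ultimately have "progress_potential r M h + 1 \<le> progress_potential r M (h * (1 - y))"
    by (simp add: progress_potential_def)
  also have "\<dots> \<le> progress_potential r M h'"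
    using assms \<open>h' \<le> h * (1 - y)\<close> by (intro progress_potential_antimono) auto
  finally show ?thesis .
next
  case False
  have "(h / 2) powr (- r) \<ge> h powr (- r)" using assms by (intro powr_mono2') auto
  then have "2 / (r * M) * h powr (- r) \<le> 2 / (r * M) * (h / 2) powr (- r)"
    using assms by (intro mult_left_mono) auto
  moreover have "log 2 (h / 2) = log 2 h - 1"
    using assms by (simp add: log_divide)
  ultimately have "progress_potential r M h + 1 \<le> progress_potential r M (h / 2)"
    by (simp add: progress_potential_def)
  also have "\<dots> \<le> progress_potential r M h'"
    using assms le False by (intro progress_potential_antimono) (auto simp: min_def)
  finally show ?thesis .
qed

text \<open>
  The count starts at index one, because only from there on is the gap controlled by the diameter.
\<close>

lemma iteration_count_bound:
  fixes h :: "nat \<Rightarrow> real"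
  assumes "r > 0" "M > 0" "H > 0"
    and large: "\<And>t. t \<le> Suc k \<Longrightarrow> h t > H"
    and step: "\<And>t. t \<le> k \<Longrightarrow> h (Suc t) \<le> h t - h t / 2 * min (M * h t powr r) 1"
  shows "real k \<le> 2 / (r * M) * H powr (- r) + log 2 (h 1 / H)"
proof -
  have "progress_potential r M (h 1) + real j \<le> progress_potential r M (h (Suc j))" if "j \<le> k" for j
    using that
  proof (induction j)
    case (Suc j)
    have "progress_potential r M (h (Suc j)) + 1 \<le> progress_potential r M (h (Suc (Suc j)))"
      using assms(1,2,3) large[of "Suc j"] large[of "Suc (Suc j)"] step[of "Suc j"] Suc.prems
      by (intro progress_potential_step) auto
    then show ?case using Suc by simp
  qed simp
  from this[of k] have "progress_potential r M (h 1) + real k \<le> progress_potential r M (h (Suc k))"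
    by simp
  also have "\<dots> \<le> progress_potential r M H"
    using assms(1,2,3) large[of "Suc k"] by (intro progress_potential_antimono) auto
  finally have "real k \<le> progress_potential r M H - progress_potential r M (h 1)" by simp
  moreover have "2 / (r * M) * h 1 powr (- r) \<ge> 0" using assms by simp
  moreover have "log 2 (h 1 / H) = log 2 (h 1) - log 2 H"
    using assms(3) large[of 1] by (simp add: log_divide)
  ultimately show ?thesis by (simp add: progress_potential_def)
qed

section \<open>Comparison with the stated bound\<close>

lemma two_powr_le_one_plus:
  fixes r :: real
  assumes "0 < r" "r < 1"
  shows "2 powr r - 1 \<le> r"
  using Youngs_inequality_0[of r "1 - r" 2 1] assms by simp

text \<open>
  With \<open>r = (q - 2) / q\<close>, the left-hand side is \<open>1 / (2 powr r - 1)\<close>.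
\<close>

lemma one_plus_beta1:
  assumes "q > 2"
  shows "1 + beta1 q \<ge> q / (q - 2)"
proof -
  define r where "r = (q - 2) / q"
  have r: "0 < r" "r < 1" using assms by (auto simp: r_def)
  have b: "2 powr r - 1 > (0::real)" using r by simp
  have "1 + (2 - b) / (b - 1) = 1 / (b - 1)" if "b - 1 > 0" for b :: real
    using that by (simp add: field_simps)
  from this[OF b] have "1 + beta1 q = 1 / (2 powr r - 1)"
    by (simp only: beta1_def r_def)
  moreover have "1 / (2 powr r - 1) \<ge> 1 / r"
    using two_powr_le_one_plus[OF r] r b by (intro divide_left_mono) auto
  ultimately show ?thesis using assms by (simp add: r_def)
qed

text \<open>
  With \<open>r = (q - 2) / q\<close>, the constant is \<open>r - (1 - r) (2 powr r - 1)\<close>, which lies between \<open>r\<^sup>2\<close> and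
  \<open>r\<close>.
\<close>

lemma beta2_bounds:
  assumes "q > 2"
  shows "0 < beta2 q" "beta2 q \<le> (q - 2) / q"
proof -
  define r where "r = (q - 2) / q"
  have r: "0 < r" "r < 1" using assms by (auto simp: r_def)
  have "2 / q = 1 - r" using assms by (simp add: r_def field_simps)
  then have eq: "beta2 q = r - (1 - r) * (2 powr r - 1)"
    by (simp only: beta2_def r_def[symmetric])
  have "(1 - r) * (2 powr r - 1) \<le> (1 - r) * r"
    using two_powr_le_one_plus[OF r] r by (intro mult_left_mono) auto
  also have "\<dots> < r" using r by (simp add: algebra_simps)
  finally show "0 < beta2 q" by (simp add: eq)
  have "1 \<le> (2::real) powr r" using r by (simp add: ge_one_powr_ge_zero)
  then have "(1 - r) * (2 powr r - 1) \<ge> 0" using r by simp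
  then show "beta2 q \<le> (q - 2) / q" by (simp add: eq r_def[symmetric])
qed

lemma log2_le_powr:
  fixes r y :: real
  assumes "r > 0" "y > 0"
  shows "log 2 y \<le> 2 * (y powr r / r)"
proof -
  have "ln (y powr r) \<le> y powr r - 1" using assms by (intro ln_le_minus_one) auto
  then have "ln y \<le> y powr r / r" using assms by (simp add: ln_powr field_simps)
  then have "log 2 y \<le> (y powr r / r) / ln 2"
    unfolding log_def by (rule divide_right_mono) simp
  also have "\<dots> \<le> (y powr r / r) / (1 / 2)"
    using ln2_ge_two_thirds assms by (intro divide_left_mono) auto
  finally show ?thesis by (simp add: mult.commute)
qed

text \<open>
  The power term is dominated by the summand of the bound with \<open>\<beta>\<^sub>2\<close>, the logarithm by the summand
  with \<open>\<beta>\<^sub>1\<close>. The factor four comes from \<open>2 powr r \<le> 2\<close> in the former.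
\<close>

lemma iteration_count_le_bound_B:
  assumes p: "p \<ge> 2" and q: "q > 2" and \<epsilon>: "\<epsilon> > 0" and a: "\<alpha> * c > 0" and h: "h > 0"
    and hD: "h \<le> (p - 1) / 2 * D\<^sup>2"
    and r: "r = (q - 2) / q" and M: "M = (\<alpha> * c) powr (2 / q) / (p - 1)"
  shows "2 / (r * M) * (\<epsilon>\<^sup>2 / 2) powr (- r) + log 2 (h / (\<epsilon>\<^sup>2 / 2)) \<le> 4 * bound_B p \<alpha> q D c \<epsilon>"
proof -
  have r01: "0 < r" "r < 1" using q by (auto simp: r)
  define A where "A = (\<alpha> * c) powr (2 / q)"
  define E where "E = \<epsilon> powr (2 * r)"
  have A: "A > 0" and E: "E > 0" using a \<epsilon> by (auto simp: A_def E_def)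
  have Eeq: "(\<epsilon>\<^sup>2) powr r = E"
  proof -
    have "\<epsilon>\<^sup>2 = \<epsilon> powr 2" using \<epsilon> by simp
    then show ?thesis by (simp only: powr_powr E_def)
  qed
  have B: "bound_B p \<alpha> q D c \<epsilon> = (p * D\<^sup>2) powr r * (1 + beta1 q) / E + (p / beta2 q) / A / E"
    by (simp add: bound_B_def r A_def E_def add_divide_distrib)
  have "(\<epsilon>\<^sup>2 / 2) powr (- r) = 2 powr r / E"
    using \<epsilon> by (simp add: powr_minus powr_divide Eeq divide_simps)
  then have "2 / (r * M) * (\<epsilon>\<^sup>2 / 2) powr (- r) = 2 * 2 powr r * ((p - 1) / r / A / E)"
    by (simp add: M A_def[symmetric])
  also have "\<dots> \<le> 4 * ((p / beta2 q) / A / E)"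
  proof (rule mult_mono)
    show "2 * 2 powr r \<le> (4::real)" using two_powr_le_one_plus[OF r01] r01 by simp
    have "(p - 1) / r \<le> p / beta2 q"
      using beta2_bounds[OF q] p by (intro frac_le) (auto simp: r)
    then show "(p - 1) / r / A / E \<le> p / beta2 q / A / E"
      using A E by (intro divide_right_mono) auto
    show "0 \<le> (p - 1) / r / A / E" using p r01 A E by simp
  qed simp
  finally have 1: "2 / (r * M) * (\<epsilon>\<^sup>2 / 2) powr (- r) \<le> 4 * ((p / beta2 q) / A / E)" .
  have h2: "2 * h \<le> p * D\<^sup>2"
  proof -
    have "2 * h \<le> (p - 1) * D\<^sup>2" using hD by simp
    also have "\<dots> \<le> p * D\<^sup>2" by (intro mult_right_mono) auto
    finally show ?thesis .
  qed
  have "log 2 (h / (\<epsilon>\<^sup>2 / 2)) \<le> log 2 (p * D\<^sup>2 / \<epsilon>\<^sup>2)"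
    using h h2 \<epsilon> by (simp add: divide_right_mono mult.commute)
  also have "\<dots> \<le> 2 * ((p * D\<^sup>2 / \<epsilon>\<^sup>2) powr r / r)"
    using h h2 \<epsilon> r01 by (intro log2_le_powr) auto
  also have "(p * D\<^sup>2 / \<epsilon>\<^sup>2) powr r / r = (p * D\<^sup>2) powr r * (1 / r) / E"
    using p by (simp add: powr_divide Eeq)
  also have "2 * \<dots> \<le> 4 * ((p * D\<^sup>2) powr r * (1 + beta1 q) / E)"
  proof (rule mult_mono)
    have "1 / r \<le> 1 + beta1 q" using one_plus_beta1[OF q] by (simp add: r)
    then show "(p * D\<^sup>2) powr r * (1 / r) / E \<le> (p * D\<^sup>2) powr r * (1 + beta1 q) / E"
      using E by (intro divide_right_mono mult_left_mono) auto
  qed (use r01 E in auto)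
  finally have 2: "log 2 (h / (\<epsilon>\<^sup>2 / 2)) \<le> 4 * ((p * D\<^sup>2) powr r * (1 + beta1 q) / E)" .
  from add_mono[OF 1 2] show ?thesis unfolding B by (simp only: distrib_left add.commute)
qed

lemma fw_cardinality_le: "fw_cardinality x0 v \<gamma> t \<le> Suc t"
proof -
  have "fw_cardinality x0 v \<gamma> t \<le> card (insert x0 (v ` {..<t}))"
    unfolding fw_cardinality_def
    by (rule card_mono) (use fw_weight_support[of x0 v \<gamma> t] in force)+
  also have "\<dots> \<le> Suc (card (v ` {..<t}))" by (rule card_insert_le_m1) auto
  also have "\<dots> \<le> Suc t" using card_image_le[of "{..<t}" v] by simp
  finally show ?thesis .
qed

theorem corollary7p2:
  shows "\<exists>K::real. K > 0 \<and>
    (\<forall>(n::nat) (p::real) (\<alpha>::real) (q::real) (\<epsilon>::real) (C::(nat \<Rightarrow> real) set) (xstar::nat \<Rightarrow> real)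
       (D::real) (c::real) (f::(nat \<Rightarrow> real) \<Rightarrow> real)
       (x::nat \<Rightarrow> nat \<Rightarrow> real) (v::nat \<Rightarrow> nat \<Rightarrow> real) (\<gamma>::nat \<Rightarrow> real).
       p \<ge> 2 \<longrightarrow> \<alpha> > 0 \<longrightarrow> q > 2 \<longrightarrow> \<epsilon> > 0 \<longrightarrow>
       C \<noteq> {} \<longrightarrow> compactin (Euclidean_space n) C \<longrightarrow> convex C \<longrightarrow>
       uniformly_convex_set n (lp_norm n p) \<alpha> q C \<longrightarrow>
       xstar \<in> rn n - C \<longrightarrow>
       D = lp_diam n p C \<longrightarrow>
       c = lp_dist n p xstar C \<longrightarrow>
       f = (\<lambda>y. 1 / 2 * (lp_norm n p (y - xstar))\<^sup>2) \<longrightarrow>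
       frank_wolfe_run n f C x v \<gamma> \<longrightarrow>
       closed_loop_steps n p f x v \<gamma> \<longrightarrow>
       (\<exists>t. x t \<in> C \<and>
            (lp_norm n p (x t - xstar))\<^sup>2 - (lp_dist n p xstar C)\<^sup>2 \<le> \<epsilon>\<^sup>2 \<and>
            real (fw_cardinality (x 0) v \<gamma> t) \<le> K * max 1 (bound_B p \<alpha> q D c \<epsilon>)))"
proof (intro exI[of _ "7::real"] conjI allI impI)
  fix n p \<alpha> q \<epsilon> C u D c f x v \<gamma>
  assume p: "(p::real) \<ge> 2" and "(\<alpha>::real) > 0" and q: "(q::real) > 2" and \<epsilon>: "(\<epsilon>::real) > 0"
    and ne: "C \<noteq> {}" and cpt: "compactin (Euclidean_space n) C" and conv: "convex C"
    and uc: "uniformly_convex_set n (lp_norm n p) \<alpha> q C"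
    and u: "u \<in> rn n - C" and D: "D = lp_diam n p C" and c: "c = lp_dist n p u C"
    and f: "f = (\<lambda>y. 1 / 2 * (lp_norm n p (y - u))\<^sup>2)"
    and run: "frank_wolfe_run n f C x v \<gamma>" and cl: "closed_loop_steps n p f x v \<gamma>"
  define B where "B = bound_B p \<alpha> q D c \<epsilon>"
  define h where "h y = (lp_norm n p (y - u))\<^sup>2 / 2 - c\<^sup>2 / 2" for y
  define r where "r = (q - 2) / q"
  define M where "M = (\<alpha> * c) powr (2 / q) / (p - 1)"
  have c0: "c > 0" unfolding c by (rule lp_dist_pos) (use p cpt ne u in auto)
  have M0: "M > 0" and r0: "r > 0" using \<open>\<alpha> > 0\<close> c0 p q by (auto simp: M_def r_def)
  have vC: "v t \<in> C" for t
    using run by (simp add: frank_wolfe_run_def extreme_point_of_def)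
  have \<gamma>01: "\<gamma> t \<in> {0..1}" and xS: "x (Suc t) = x t + \<gamma> t *\<^sub>R (v t - x t)" for t
    using run by (simp_all add: frank_wolfe_run_def)
  have xC: "x t \<in> C" for t
  proof (induction t)
    case 0
    then show ?case using run by (simp add: frank_wolfe_run_def extreme_point_of_def)
  next
    case (Suc t)
    have "(1 - \<gamma> t) *\<^sub>R x t + \<gamma> t *\<^sub>R v t \<in> C"
      using conv Suc vC \<gamma>01[of t] by (intro convexD_alt) auto
    moreover have "x (Suc t) = (1 - \<gamma> t) *\<^sub>R x t + \<gamma> t *\<^sub>R v t"
      unfolding xS by (simp add: fun_eq_iff algebra_simps)
    ultimately show ?case by (simp only:)
  qed
  have grad: "gradient n f (x t) = lp_dual n p (x t - u)" for t
    unfolding f using p lp_dist_le[OF xC, of n p u t] c0 c by (intro gradient_half_sq_lp_eq_dual) auto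
  have progress: "h (x (Suc t)) \<le> h (x t) - h (x t) / 2 * min (M * h (x t) powr r) 1"
    "h (x (Suc t)) \<le> (p - 1) / 2 * D\<^sup>2" if "h (x t) > 0" for t
  proof -
    have min: "inner_n n (v t) (lp_dual n p (x t - u)) \<le> inner_n n y (lp_dual n p (x t - u))"
      if "y \<in> C" for y
      using run that unfolding frank_wolfe_run_def is_arg_min_linorder grad by blast
    have step: "\<gamma> t = Orderings.min (inner_n n (x t - v t) (lp_dual n p (x t - u)) /
          ((p - 1) * (lp_norm n p (x t - v t))\<^sup>2)) 1" if "v t \<noteq> x t"
      using cl that unfolding closed_loop_steps_def grad by blast
    note * = closed_loop_step_progress[OF p q cpt conv uc u c xC vC \<gamma>01 refl min step h_def[abs_def, THEN meta_eq_to_obj_eq] that xS]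
    show "h (x (Suc t)) \<le> h (x t) - h (x t) / 2 * Orderings.min (M * h (x t) powr r) 1"
      and "h (x (Suc t)) \<le> (p - 1) / 2 * D\<^sup>2"
      using * unfolding M_def r_def D by auto
  qed
  \<comment> \<open>As \<open>k > 4 B\<close>, the gap cannot stay large up to index \<open>Suc k\<close>. The cardinality is then at most
      \<open>Suc (Suc k) \<le> 4 max 1 B + 3\<close>, whence the constant seven.\<close>
  define k where "k = nat \<lfloor>4 * B\<rfloor> + 1"
  have "\<exists>t\<le>Suc k. h (x t) \<le> \<epsilon>\<^sup>2 / 2"
  proof (rule ccontr)
    assume "\<not> ?thesis"
    then have large: "h (x t) > \<epsilon>\<^sup>2 / 2" if "t \<le> Suc k" for t using that by (meson not_le)
    have pos: "h (x t) > 0" if "t \<le> Suc k" for t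
      using large[OF that] zero_le_power2[of \<epsilon>] by linarith
    have "real k \<le> 2 / (r * M) * (\<epsilon>\<^sup>2 / 2) powr (- r) + log 2 (h (x 1) / (\<epsilon>\<^sup>2 / 2))"
      using r0 M0 \<epsilon> large progress(1) pos by (intro iteration_count_bound) auto
    also have "\<dots> \<le> 4 * B"
      unfolding B_def using p q \<epsilon> \<open>\<alpha> > 0\<close> c0 pos[of 1] progress(2)[OF pos[of 0]] r_def M_def
      by (intro iteration_count_le_bound_B) auto
    finally show False unfolding k_def by linarith
  qed
  then obtain t where t: "t \<le> Suc k" "h (x t) \<le> \<epsilon>\<^sup>2 / 2" by blast
  have "real (fw_cardinality (x 0) v \<gamma> t) \<le> real (Suc t)"
    using fw_cardinality_le by (rule of_nat_mono)
  also have "\<dots> \<le> real (nat \<lfloor>4 * B\<rfloor>) + 3" using t(1) by (simp add: k_def)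
  also have "\<dots> \<le> 7 * max 1 B" by linarith
  finally have "real (fw_cardinality (x 0) v \<gamma> t) \<le> 7 * max 1 (bound_B p \<alpha> q D c \<epsilon>)"
    by (simp add: B_def)
  moreover have "(lp_norm n p (x t - u))\<^sup>2 - (lp_dist n p u C)\<^sup>2 \<le> \<epsilon>\<^sup>2"
    using t(2) by (simp add: h_def c)
  ultimately show "\<exists>t. x t \<in> C \<and> (lp_norm n p (x t - u))\<^sup>2 - (lp_dist n p u C)\<^sup>2 \<le> \<epsilon>\<^sup>2 \<and>
      real (fw_cardinality (x 0) v \<gamma> t) \<le> 7 * max 1 (bound_B p \<alpha> q D c \<epsilon>)"
    using xC by blast
qed simp

end
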